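(* Let $d>3$ be an integer, $N\ge d$, and $\tau>0$. Let $\mathbb{P}_d=\{-P_d^{(1)},\dots,-P_d^{(r)}\}$ be the multiset of pairwise interaction matrices of a sequence of $d$-groups in $\{1,\dots,N\}$, and let $\mathbb{T}_d=\{-T_d^{(1)},\dots,-T_d^{(r')}\}$ be the multiset of three-way interaction matrices of a (possibly different) sequence of $d$-groups in $\{1,\dots,N\}$. Suppose that $\mu^*<0$ is a common eigenvalue of the two aggregated matrices $\frac1r\sum_{\ell=1}^{r}(-P_d^{(\ell)})$ and $\frac1{r'}\sum_{\ell=1}^{r'}(-T_d^{(\ell)})$. Then the corresponding eigenvalues of the effective temporal matrices, $$\hat\mu(\mathbb{P}_d)=\tau^{-1}\ln\left(1+\alpha(-d,\tau)\mu^*\right),\qquad \hat\mu(\mathbb{T}_d)=\tau^{-1}\ln\left(1+\alpha(-d(d-2),\tau)\mu^*\right),$$ where $\alpha(c,\tau)=\frac{e^{c\tau}-1}{c}$, satisfy $$\hat\mu(\mathbb{P}_d)<\hat\mu(\mathbb{T}_d).$$ That is, for the same aggregated dynamics, the temporal dynamics with three-way interactions is slower than the temporal dynamics with pairwise interactions.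
   Context: A $d$-group is a $d$-element subset $g$ of the node set $\{1,\dots,N\}$. Its pairwise interaction Laplacian $P_d\in\mathbb{R}^{N\times N}$ is the graph Laplacian of the complete graph on $g$ (other nodes isolated): $(P_d)_{ij}=d-1$ if $i=j\in g$, $(P_d)_{ij}=-1$ if $i\ne j$ and $i,j\in g$, and $(P_d)_{ij}=0$ otherwise. Its three-way interaction (motif) Laplacian is $T_d=(d-2)P_d$ (each pair of nodes of $g$ is weighted by the number $d-2$ of triples of $g$ containing it). For a multiset $\mathbb{M}=\{M^{(1)},\dots,M^{(r)}\}$ of matrices, the aggregated matrix is $\frac1r\sum_\ell M^{(\ell)}$ and the effective temporal matrix is $\tau^{-1}\ln\left(\frac1r\sum_\ell\exp(\tau M^{(\ell)})\right)$, with $\ln$ the principal matrix logarithm. A negative eigenvalue closer to $0$ means slower relaxation. *)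

theory Defs
  imports
    "HOL-Analysis.Analysis"
    "HOL-Library.Multiset"
    "Jordan_Normal_Form.Char_Poly"
begin

text \<open>
  Matrix indices start at 0, so the nodes 1, ..., N of the mathematical text are the
  numbers 0, ..., N - 1 here, and a d-group is a d-element subset of this set.
\<close>

definition d_group :: "nat \<Rightarrow> nat \<Rightarrow> nat set \<Rightarrow> bool" where
  "d_group N d g \<longleftrightarrow> g \<subseteq> {0..<N} \<and> card g = d"

definition pairwise_laplacian :: "nat \<Rightarrow> nat \<Rightarrow> nat set \<Rightarrow> real mat" where
  "pairwise_laplacian N d g = mat N N (\<lambda>(i, j).
     if i \<in> g \<and> j \<in> g then (if i = j then real d - 1 else - 1) else 0)"

definition threeway_laplacian :: "nat \<Rightarrow> nat \<Rightarrow> nat set \<Rightarrow> real mat" where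
  "threeway_laplacian N d g = (real d - 2) \<cdot>\<^sub>m pairwise_laplacian N d g"

text \<open>
  The type of matrices of all sizes has no neutral element of addition independent of the size,
  so the mean is taken entrywise.
\<close>

definition mean_mat :: "nat \<Rightarrow> real mat multiset \<Rightarrow> real mat" where
  "mean_mat N Ms = mat N N (\<lambda>(i, j). (\<Sum>M\<in>#Ms. M $$ (i, j)) / real (size Ms))"

text \<open>The exponential series of a square matrix, which converges entrywise.\<close>

definition mat_exp :: "'a :: {real_normed_field, banach} mat \<Rightarrow> 'a mat" where
  "mat_exp A = mat (dim_row A) (dim_row A) (\<lambda>(i, j). \<Sum>k. (A ^\<^sub>m k) $$ (i, j) / fact k)"

text \<open>
  The principal logarithm of a square matrix without eigenvalues in the closed negative real
  axis is its unique logarithm all of whose eigenvalues lie in the open strip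
  of imaginary parts between \<open>-pi\<close> and \<open>pi\<close>. The candidates range over all complex matrices.
\<close>

definition is_principal_ln :: "complex mat \<Rightarrow> complex mat \<Rightarrow> bool" where
  "is_principal_ln A X \<longleftrightarrow>
     X \<in> carrier_mat (dim_row A) (dim_row A) \<and> mat_exp X = A \<and>
     (\<forall>z. eigenvalue X z \<longrightarrow> - pi < Im z \<and> Im z < pi)"

definition principal_ln :: "complex mat \<Rightarrow> complex mat" where
  "principal_ln A = (THE X. is_principal_ln A X)"

definition aggregated_mat :: "nat \<Rightarrow> real mat multiset \<Rightarrow> real mat" where
  "aggregated_mat N Ms = mean_mat N Ms"

definition effective_mat :: "nat \<Rightarrow> real \<Rightarrow> real mat multiset \<Rightarrow> complex mat" where
  "effective_mat N \<tau> Ms =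
     complex_of_real (1 / \<tau>) \<cdot>\<^sub>m
       principal_ln (map_mat complex_of_real (mean_mat N {#mat_exp (\<tau> \<cdot>\<^sub>m M). M \<in># Ms#}))"

definition alpha :: "real \<Rightarrow> real \<Rightarrow> real" where
  "alpha c \<tau> = (exp (c * \<tau>) - 1) / c"

end

theory Submission
  imports
    Defs
    "Jordan_Normal_Form.Jordan_Normal_Form_Existence"
    "Jordan_Normal_Form.Jordan_Normal_Form_Uniqueness"
begin

text \<open>
  A group Laplacian satisfies \<open>P\<^sup>2 = d P\<close>, so with \<open>c = -d\<close> (pairwise) or \<open>c = -d (d - 2)\<close>
  (three-way) each exponential is \<open>1 + \<alpha>(c, \<tau>) M\<close>, and their mean is
  \<open>1 + \<alpha>(c, \<tau>) A\<close> for the aggregated matrix \<open>A\<close>. This mean is Hermitian and, as \<open>P \<le> d\<close>,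
  bounded below by \<open>exp (c \<tau>) > 0\<close>. It is therefore diagonalizable with positive eigenvalues,
  which gives a principal logarithm; conversely any logarithm with spectrum in the strip is forced
  to act as the scalar \<open>ln x\<close> on the eigenspace for \<open>x\<close>, so the logarithm is unique and its
  eigenvalues are as claimed. Finally, with \<open>q = exp (- d \<tau>)\<close> the comparison of the two values
  of \<open>\<alpha>\<close> is Bernoulli's inequality \<open>1 - q\<^sup>k < k (1 - q)\<close> for \<open>k = d - 2 \<ge> 2\<close>.
\<close>

unbundle no inner_syntax
unbundle no vec_syntax

subsection \<open>The matrix exponential\<close>

lemma mult_mat_vec_index:
  assumes "A \<in> carrier_mat n n" "v \<in> carrier_vec n" "i < n"
  shows "(A *\<^sub>v v) $ i = (\<Sum>j<n. A $$ (i, j) * v $ j)"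
  using assms by (auto simp: scalar_prod_def lessThan_atLeast0 intro!: sum.cong)

text \<open>Each further factor of \<open>X\<close> turns an entry into a sum of \<open>n\<close>
  products, which costs at most a factor \<open>n * b\<close>. The bound is crude but geometric, so
  division by \<open>fact k\<close> makes it summable.\<close>

lemma pow_mat_entry_bound:
  fixes X :: "'a :: real_normed_field mat"
  assumes X: "X \<in> carrier_mat n n"
    and b: "\<And>i j. i < n \<Longrightarrow> j < n \<Longrightarrow> norm (X $$ (i, j)) \<le> b" and b0: "b \<ge> 0"
    and "i < n" "j < n"
  shows "norm ((X ^\<^sub>m k) $$ (i, j)) \<le> (real n * b) ^ k"
  using assms(4,5)
proof (induction k arbitrary: i j)
  case 0
  then show ?case using X by auto
next
  case (Suc k)
  have "(X ^\<^sub>m Suc k) $$ (i, j) = (\<Sum>l<n. (X ^\<^sub>m k) $$ (i, l) * X $$ (l, j))"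
    using X Suc.prems by (auto simp: scalar_prod_def lessThan_atLeast0 intro!: sum.cong)
  also have "norm \<dots> \<le> (\<Sum>l<n. (real n * b) ^ k * b)"
    by (rule sum_norm_le)
      (use Suc b b0 in \<open>auto simp: norm_mult intro!: mult_mono\<close>)
  also have "\<dots> = (real n * b) ^ Suc k" by simp
  finally show ?case .
qed

lemma mat_exp_entry_summable:
  fixes X :: "'a :: {real_normed_field, banach} mat"
  assumes X: "X \<in> carrier_mat n n" and "i < n" "j < n"
  shows "summable (\<lambda>k. (X ^\<^sub>m k) $$ (i, j) / fact k)"
proof -
  \<comment> \<open>The sum of the norms of all entries is a single bound for every entry, and it is
    nonnegative even when \<open>n = 0\<close>.\<close>
  define b where "b = (\<Sum>i<n. \<Sum>j<n. norm (X $$ (i, j)))"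
  have "norm (X $$ (i, j)) \<le> b" if "i < n" "j < n" for i j
  proof -
    have "norm (X $$ (i, j)) \<le> (\<Sum>j<n. norm (X $$ (i, j)))"
      using that by (intro member_le_sum) auto
    also have "\<dots> \<le> b" unfolding b_def
      using that by (intro member_le_sum[of i _ "\<lambda>i. \<Sum>j<n. norm (X $$ (i, j))"]) (auto intro: sum_nonneg)
    finally show ?thesis .
  qed
  moreover have "b \<ge> 0" unfolding b_def by (intro sum_nonneg) auto
  ultimately have le: "norm ((X ^\<^sub>m k) $$ (i, j)) \<le> (real n * b) ^ k" for k
    using pow_mat_entry_bound[OF X] assms(2,3) by blast
  have "norm ((X ^\<^sub>m k) $$ (i, j) / fact k) \<le> (real n * b) ^ k / fact k" for k
    using divide_right_mono[OF le[of k], of "fact k"] by (simp add: norm_divide)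
  moreover have "summable (\<lambda>k. (real n * b) ^ k / fact k)"
    using summable_exp[of "real n * b"] by (simp add: divide_inverse mult.commute)
  ultimately show ?thesis
    using summable_comparison_test'[of "\<lambda>k. (real n * b) ^ k / fact k" 0
        "\<lambda>k. (X ^\<^sub>m k) $$ (i, j) / fact k"] by simp
qed

lemma mat_exp_carrier [simp]: "X \<in> carrier_mat n n \<Longrightarrow> mat_exp X \<in> carrier_mat n n"
  by (auto simp: mat_exp_def)

text \<open>Transfers the entrywise series to the action on a vector. The facts below on how
  \<open>mat_exp X\<close> acts on vectors are read off from this series by uniqueness of
  limits.\<close>

lemma mat_exp_mult_vec_sums:
  fixes X :: "'a :: {real_normed_field, banach} mat"
  assumes X: "X \<in> carrier_mat n n" and v: "v \<in> carrier_vec n" and i: "i < n"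
  shows "(\<lambda>k. (X ^\<^sub>m k *\<^sub>v v) $ i / fact k) sums (mat_exp X *\<^sub>v v) $ i"
proof -
  have "(\<lambda>k. \<Sum>j<n. (X ^\<^sub>m k) $$ (i, j) / fact k * v $ j)
          sums (\<Sum>j<n. mat_exp X $$ (i, j) * v $ j)"
    using X i by (intro sums_sum sums_mult2)
      (auto simp: mat_exp_def intro!: summable_sums mat_exp_entry_summable)
  moreover have "(\<Sum>j<n. (X ^\<^sub>m k) $$ (i, j) / fact k * v $ j) = (X ^\<^sub>m k *\<^sub>v v) $ i / fact k" for k
    using mult_mat_vec_index[OF pow_carrier_mat[OF X] v i, of k] by (simp add: sum_divide_distrib)
  ultimately show ?thesis using mult_mat_vec_index[OF mat_exp_carrier[OF X] v i] by simp
qed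

text \<open>Powers are built by multiplying on the right; here the extra factor is moved to the
  left, where it acts on an already computed vector.\<close>

lemma pow_mat_Suc_vec:
  assumes X: "X \<in> carrier_mat n n" and v: "v \<in> carrier_vec n"
  shows "X ^\<^sub>m Suc k *\<^sub>v v = X *\<^sub>v (X ^\<^sub>m k *\<^sub>v v)"
  using v
proof (induction k arbitrary: v)
  case 0
  then show ?case using X by auto
next
  case (Suc k)
  have "X ^\<^sub>m Suc (Suc k) *\<^sub>v v = X ^\<^sub>m Suc k *\<^sub>v (X *\<^sub>v v)"
    using X Suc.prems by (auto intro: assoc_mult_mat_vec pow_carrier_mat mult_carrier_mat)
  also have "\<dots> = X *\<^sub>v (X ^\<^sub>m k *\<^sub>v (X *\<^sub>v v))" using X Suc by simp
  also have "X ^\<^sub>m k *\<^sub>v (X *\<^sub>v v) = X ^\<^sub>m Suc k *\<^sub>v v"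
    using X Suc.prems by (auto intro: assoc_mult_mat_vec[symmetric] pow_carrier_mat)
  finally show ?case .
qed

text \<open>Every power of \<open>X\<close> commutes with \<open>X\<close>, and the finite sums in a
  matrix-vector product pass through the series. Consequently the eigenspaces of
  \<open>mat_exp X\<close> are invariant under \<open>X\<close>.\<close>

lemma mat_exp_commute_vec:
  fixes X :: "'a :: {real_normed_field, banach} mat"
  assumes X: "X \<in> carrier_mat n n" and v: "v \<in> carrier_vec n"
  shows "mat_exp X *\<^sub>v (X *\<^sub>v v) = X *\<^sub>v (mat_exp X *\<^sub>v v)"
proof (intro eq_vecI)
  fix i assume "i < dim_vec (X *\<^sub>v (mat_exp X *\<^sub>v v))"
  then have i: "i < n" using X by simp
  have Xv: "X *\<^sub>v v \<in> carrier_vec n" using X v by simp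
  have "(\<lambda>k. \<Sum>j<n. X $$ (i, j) * ((X ^\<^sub>m k *\<^sub>v v) $ j / fact k))
          sums (\<Sum>j<n. X $$ (i, j) * (mat_exp X *\<^sub>v v) $ j)"
    using mat_exp_mult_vec_sums[OF X v] by (intro sums_sum sums_mult) auto
  moreover have "(\<Sum>j<n. X $$ (i, j) * ((X ^\<^sub>m k *\<^sub>v v) $ j / fact k))
      = (X ^\<^sub>m k *\<^sub>v (X *\<^sub>v v)) $ i / fact k" for k
  proof -
    have "X ^\<^sub>m k *\<^sub>v (X *\<^sub>v v) = X *\<^sub>v (X ^\<^sub>m k *\<^sub>v v)"
      unfolding pow_mat_Suc_vec[OF X v, symmetric]
      using X v by (auto intro: assoc_mult_mat_vec[symmetric] pow_carrier_mat)
    then show ?thesis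
      using mult_mat_vec_index[OF X mult_mat_vec_carrier[OF pow_carrier_mat[OF X] v] i]
      by (simp add: sum_divide_distrib)
  qed
  ultimately have "(\<lambda>k. (X ^\<^sub>m k *\<^sub>v (X *\<^sub>v v)) $ i / fact k)
      sums (X *\<^sub>v (mat_exp X *\<^sub>v v)) $ i"
    using mult_mat_vec_index[OF X mult_mat_vec_carrier[OF mat_exp_carrier[OF X] v] i] by simp
  then show "(mat_exp X *\<^sub>v (X *\<^sub>v v)) $ i = (X *\<^sub>v (mat_exp X *\<^sub>v v)) $ i"
    using mat_exp_mult_vec_sums[OF X Xv i] sums_unique2 by blast
qed (use X carrier_matD(1)[OF mat_exp_carrier[OF X]] in auto)

text \<open>On a chain of length at most two, the powers of \<open>X\<close> produce
  \<open>z ^ k\<close> and its derivative in \<open>z\<close>. Both series sum to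
  \<open>exp z\<close>, since the exponential is its own derivative.\<close>

lemma mat_exp_generalized_eigenvector:
  fixes X :: "'a :: {real_normed_field, banach} mat"
  assumes X: "X \<in> carrier_mat n n" and v: "v \<in> carrier_vec n" and w: "w \<in> carrier_vec n"
    and Xv: "X *\<^sub>v v = z \<cdot>\<^sub>v v + w" and Xw: "X *\<^sub>v w = z \<cdot>\<^sub>v w"
  shows "mat_exp X *\<^sub>v v = exp z \<cdot>\<^sub>v (v + w)"
proof (intro eq_vecI)
  fix i assume "i < dim_vec (exp z \<cdot>\<^sub>v (v + w))"
  then have i: "i < n" using w by simp
  \<comment> \<open>At \<open>k = 0\<close> the truncated exponent \<open>k - 1\<close> does no
    harm, because it is multiplied by \<open>of_nat k\<close>, which is zero.\<close>
  have pw: "X ^\<^sub>m k *\<^sub>v v = z ^ k \<cdot>\<^sub>v v + (of_nat k * z ^ (k - 1)) \<cdot>\<^sub>v w" for k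
  proof (induction k)
    case 0
    then show ?case using X v w by auto
  next
    case (Suc k)
    have "X ^\<^sub>m Suc k *\<^sub>v v = X *\<^sub>v (z ^ k \<cdot>\<^sub>v v + (of_nat k * z ^ (k - 1)) \<cdot>\<^sub>v w)"
      using pow_mat_Suc_vec[OF X v] Suc by simp
    also have "\<dots> = z ^ k \<cdot>\<^sub>v (X *\<^sub>v v) + (of_nat k * z ^ (k - 1)) \<cdot>\<^sub>v (X *\<^sub>v w)"
      using X v w by (simp add: mult_add_distrib_mat_vec mult_mat_vec)
    also have "\<dots> = z ^ Suc k \<cdot>\<^sub>v v + (of_nat (Suc k) * z ^ (Suc k - 1)) \<cdot>\<^sub>v w"
      unfolding Xv Xw using v w
      by (intro eq_vecI) (cases k; auto simp: algebra_simps)+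
    finally show ?case .
  qed
  have e: "(\<lambda>k. z ^ k / fact k) sums exp z"
    using exp_converges[of z] by (simp add: scaleR_conv_of_real divide_inverse mult.commute)
  \<comment> \<open>The term at index 0 vanishes, so the differentiated series is the exponential
    series shifted by one.\<close>
  have "(\<lambda>k. of_nat (Suc k) * z ^ (Suc k - 1) / fact (Suc k)) = (\<lambda>k. z ^ k / fact k)"
    by (simp add: fun_eq_iff del: of_nat_Suc)
  with e have "(\<lambda>k. of_nat k * z ^ (k - 1) / fact k) sums exp z"
    using sums_Suc_iff[of "\<lambda>k. of_nat k * z ^ (k - 1) / fact k" "exp z"] by simp
  then have "(\<lambda>k. z ^ k / fact k * v $ i + of_nat k * z ^ (k - 1) / fact k * w $ i)
      sums (exp z * v $ i + exp z * w $ i)"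
    by (intro sums_add sums_mult2 e)
  moreover have "z ^ k / fact k * v $ i + of_nat k * z ^ (k - 1) / fact k * w $ i
      = (X ^\<^sub>m k *\<^sub>v v) $ i / fact k" for k
    unfolding pw using v w i by (simp add: add_divide_distrib)
  ultimately show "(mat_exp X *\<^sub>v v) $ i = (exp z \<cdot>\<^sub>v (v + w)) $ i"
    using mat_exp_mult_vec_sums[OF X v i] v w i by (simp add: sums_unique2 distrib_left)
qed (use carrier_matD(1)[OF mat_exp_carrier[OF X]] w in auto)

lemma mat_exp_eigenvector:
  fixes X :: "'a :: {real_normed_field, banach} mat"
  assumes X: "X \<in> carrier_mat n n" and v: "v \<in> carrier_vec n" and Xv: "X *\<^sub>v v = z \<cdot>\<^sub>v v"
  shows "mat_exp X *\<^sub>v v = exp z \<cdot>\<^sub>v v"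
proof -
  have "X *\<^sub>v 0\<^sub>v n = z \<cdot>\<^sub>v 0\<^sub>v n" using X by auto
  then have "mat_exp X *\<^sub>v v = exp z \<cdot>\<^sub>v (v + 0\<^sub>v n)"
    using v Xv by (intro mat_exp_generalized_eigenvector[OF X]) simp_all
  then show ?thesis using v by simp
qed

subsection \<open>Logarithms on eigenspaces of the exponential\<close>

text \<open>The operator X - z acts on vectors directly, so that a product of linear factors in
  \<open>X\<close> is a \<open>fold\<close> over the list of its roots.\<close>

definition shift_apply :: "'a :: comm_ring_1 mat \<Rightarrow> 'a \<Rightarrow> 'a vec \<Rightarrow> 'a vec" where
  "shift_apply X z u = X *\<^sub>v u - z \<cdot>\<^sub>v u"

lemma shift_apply_carrier [simp]:
  "X \<in> carrier_mat n n \<Longrightarrow> u \<in> carrier_vec n \<Longrightarrow> shift_apply X z u \<in> carrier_vec n"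
  by (simp add: shift_apply_def)

lemma shift_apply_zero [simp]:
  fixes X :: "'a :: field mat"
  shows "X \<in> carrier_mat n n \<Longrightarrow> shift_apply X z (0\<^sub>v n) = 0\<^sub>v n"
  by (auto simp: shift_apply_def)

lemma shift_apply_eq_zero_iff:
  assumes "X \<in> carrier_mat n n" "u \<in> carrier_vec n"
  shows "shift_apply X z u = 0\<^sub>v n \<longleftrightarrow> X *\<^sub>v u = z \<cdot>\<^sub>v u"
  using assms by (auto simp: shift_apply_def vec_eq_iff simp del: index_mult_mat_vec)

lemma mult_shift_apply:
  fixes X :: "'a :: field mat"
  assumes "X \<in> carrier_mat n n" "Y \<in> carrier_mat n n" "u \<in> carrier_vec n"
    and "Y *\<^sub>v (X *\<^sub>v u) = X *\<^sub>v (Y *\<^sub>v u)"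
  shows "Y *\<^sub>v shift_apply X z u = shift_apply X z (Y *\<^sub>v u)"
  using assms by (simp add: shift_apply_def mult_minus_distrib_mat_vec[of _ n n] mult_mat_vec[of _ n n])

lemma shift_apply_commute:
  fixes X :: "'a :: field mat"
  assumes X: "X \<in> carrier_mat n n" and u: "u \<in> carrier_vec n"
  shows "shift_apply X y (shift_apply X z u) = shift_apply X z (shift_apply X y u)"
  unfolding shift_apply_def
  using X u mult_mat_vec_carrier[OF X u] mult_mat_vec_carrier[OF X mult_mat_vec_carrier[OF X u]]
  by (intro eq_vecI) (simp_all add: mult_minus_distrib_mat_vec[of _ n n] mult_mat_vec[of _ n n]
      algebra_simps del: index_mult_mat_vec)

text \<open>
  In triangular form, applying \<open>X - z\<close> with \<open>z\<close> the \<open>k\<close>-th diagonal entry kills the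
  \<open>k\<close>-th coordinate of a vector whose later coordinates vanish.
\<close>

lemma fold_shift_apply_zero:
  fixes X :: "complex mat"
  assumes X: "X \<in> carrier_mat n n"
  obtains zs where "\<And>u. u \<in> carrier_vec n \<Longrightarrow> fold (shift_apply X) zs u = 0\<^sub>v n"
proof -
  from char_poly_factorized[OF X] obtain as where
    as: "char_poly X = (\<Prod>a\<leftarrow>as. [:- a, 1:])" by auto
  obtain B P Q where BPQ: "schur_decomposition X as = (B, P, Q)"
    by (cases "schur_decomposition X as") auto
  from schur_decomposition[OF X as BPQ] have sim: "similar_mat_wit X B P Q"
    and ut: "upper_triangular B" by auto
  note w = similar_mat_witD2[OF X sim]
  have QX: "Q *\<^sub>v (X *\<^sub>v u) = B *\<^sub>v (Q *\<^sub>v u)" if u: "u \<in> carrier_vec n" for u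
  proof -
    note BQ = mult_carrier_mat[OF w(5,7)]
    have "X = P * (B * Q)" unfolding w(3) by (rule assoc_mult_mat[OF w(6,5,7)])
    then have "Q * X = Q * P * (B * Q)" by (simp only: assoc_mult_mat[OF w(7,6) BQ])
    also have "\<dots> = B * Q" unfolding w(2) by (rule left_mult_one_mat[OF BQ])
    finally show ?thesis
      using assoc_mult_mat_vec[OF w(7) X u] assoc_mult_mat_vec[OF w(5,7) u] by simp
  qed
  \<comment> \<open>\<open>Q *\<^sub>v u\<close> lists the coordinates of \<open>u\<close> in the
    Schur basis, where \<open>X\<close> acts as the triangular \<open>B\<close>. The induction is on
    the number \<open>k\<close> of leading coordinates that may still be nonzero; \<open>rev\<close>
    makes the diagonal entry of the last of them act first.\<close>
  have zero: "fold (shift_apply X) (map (\<lambda>i. B $$ (i, i)) (rev [0..<k])) u = 0\<^sub>v n"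
    if "u \<in> carrier_vec n" "k \<le> n" "\<And>i. k \<le> i \<Longrightarrow> i < n \<Longrightarrow> (Q *\<^sub>v u) $ i = 0" for k u
    using that
  proof (induction k arbitrary: u)
    case 0
    have "Q *\<^sub>v u = 0\<^sub>v n" using 0 w by (intro eq_vecI) auto
    then have "P *\<^sub>v (Q *\<^sub>v u) = 0\<^sub>v n" using w by auto
    moreover have "P *\<^sub>v (Q *\<^sub>v u) = P * Q *\<^sub>v u"
      using assoc_mult_mat_vec[OF w(6,7) 0(1)] ..
    ultimately have "P * Q *\<^sub>v u = 0\<^sub>v n" by simp
    then show ?case using w(1) 0(1) by simp
  next
    case (Suc k)
    let ?z = "B $$ (k, k)"
    have "(Q *\<^sub>v shift_apply X ?z u) $ i = 0" if i: "k \<le> i" "i < n" for i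
    proof -
      have Qu: "Q *\<^sub>v u \<in> carrier_vec n" using w Suc.prems by simp
      have "Q *\<^sub>v shift_apply X ?z u = B *\<^sub>v (Q *\<^sub>v u) - ?z \<cdot>\<^sub>v (Q *\<^sub>v u)"
        unfolding shift_apply_def
        using mult_minus_distrib_mat_vec[OF w(7) mult_mat_vec_carrier[OF X Suc.prems(1)], of "?z \<cdot>\<^sub>v u"]
          mult_mat_vec[OF w(7) Suc.prems(1), of ?z] QX[OF Suc.prems(1)] Suc.prems(1) by simp
      then have "(Q *\<^sub>v shift_apply X ?z u) $ i
          = (\<Sum>j<n. B $$ (i, j) * (Q *\<^sub>v u) $ j) - ?z * (Q *\<^sub>v u) $ i"
        using mult_mat_vec_index[OF w(5) Qu i(2)] Qu i w by (simp del: index_mult_mat_vec)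
      \<comment> \<open>For \<open>j < k\<close> the entry lies below the diagonal, as
        \<open>k \<le> i\<close>; for \<open>j > k\<close> the coordinate of \<open>u\<close>
        vanishes. The surviving term \<open>j = k\<close> is cancelled by the shift if
        \<open>i = k\<close> and is zero if \<open>i > k\<close>.\<close>
      also have "(\<Sum>j<n. B $$ (i, j) * (Q *\<^sub>v u) $ j) = (\<Sum>j\<in>{k}. B $$ (i, j) * (Q *\<^sub>v u) $ j)"
      proof (rule sum.mono_neutral_right)
        show "\<forall>j\<in>{..<n} - {k}. B $$ (i, j) * (Q *\<^sub>v u) $ j = 0"
        proof
          fix j assume j: "j \<in> {..<n} - {k}"
          show "B $$ (i, j) * (Q *\<^sub>v u) $ j = 0"
          proof (cases "j < k")
            case True
            then show ?thesis using ut i w by auto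
          next
            case False
            then show ?thesis using Suc.prems(3)[of j] j by auto
          qed
        qed
      qed (use Suc.prems in auto)
      also have "\<dots> - ?z * (Q *\<^sub>v u) $ i = 0"
      proof (cases "i = k")
        case False
        then have "B $$ (i, k) = 0" using ut i w by auto
        then show ?thesis using Suc.prems(3)[of i] i False by (simp del: index_mult_mat_vec)
      qed simp
      finally show ?thesis .
    qed
    then show ?case using Suc X by simp
  qed
  show thesis by (rule that, rule zero[of _ n]) auto
qed

text \<open>\<open>X\<close> preserves the eigenspace \<open>E\<close> of \<open>mat_exp X\<close>
  for \<open>x\<close>. There the strip admits only the eigenvalue \<open>ln x\<close>, and Jordan
  chains of length two are excluded. Some product of linear factors in \<open>X\<close> annihilates
  every vector, and on \<open>E\<close> all its factors can be stripped until X - ln x alone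
  annihilates.\<close>

lemma principal_log_eigenvector:
  fixes X :: "complex mat"
  assumes X: "X \<in> carrier_mat n n"
    and strip: "\<And>z. eigenvalue X z \<Longrightarrow> - pi < Im z \<and> Im z < pi"
    and v: "v \<in> carrier_vec n" and ev: "mat_exp X *\<^sub>v v = complex_of_real x \<cdot>\<^sub>v v" and x: "x > 0"
  shows "X *\<^sub>v v = complex_of_real (ln x) \<cdot>\<^sub>v v"
proof -
  define l where "l = complex_of_real (ln x)"
  have el: "exp l = complex_of_real x" unfolding l_def using x by (simp add: exp_of_real)
  define E where "E = {u \<in> carrier_vec n. mat_exp X *\<^sub>v u = exp l \<cdot>\<^sub>v u}"
  have EC: "u \<in> carrier_vec n" if "u \<in> E" for u using that by (simp add: E_def)
  have ED: "shift_apply X z u \<in> E" if "u \<in> E" for z u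
    using that X mult_shift_apply[OF X mat_exp_carrier[OF X] EC[OF that] mat_exp_commute_vec[OF X EC[OF that]]]
    by (auto simp: E_def shift_apply_def mult_mat_vec[of _ n n] smult_smult_assoc
        minus_add_uminus_vec[of _ n] smult_add_distrib_vec[of _ n] ac_simps)
  have rank2: "mat_exp X *\<^sub>v u = exp z \<cdot>\<^sub>v (u + shift_apply X z u)"
    if "u \<in> carrier_vec n" "shift_apply X z (shift_apply X z u) = 0\<^sub>v n" for u z
  proof (rule mat_exp_generalized_eigenvector[OF X that(1)])
    show "X *\<^sub>v u = z \<cdot>\<^sub>v u + shift_apply X z u"
      using that X mult_mat_vec_carrier[OF X that(1)]
      by (intro eq_vecI) (auto simp: shift_apply_def simp del: index_mult_mat_vec)
    show "X *\<^sub>v shift_apply X z u = z \<cdot>\<^sub>v shift_apply X z u"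
      using that X shift_apply_eq_zero_iff[OF X shift_apply_carrier[OF X that(1)]] by blast
  qed (simp_all add: that(1) X)
  have A: "z = l" if u: "u \<in> E" "u \<noteq> 0\<^sub>v n" and zu: "shift_apply X z u = 0\<^sub>v n" for z u
  proof -
    have "exp l \<cdot>\<^sub>v u = exp z \<cdot>\<^sub>v u"
      using mat_exp_eigenvector[OF X EC[OF u(1)], of z] zu shift_apply_eq_zero_iff[OF X EC[OF u(1)]] u(1)
      unfolding E_def by simp
    moreover obtain i where "i < n" "u $ i \<noteq> 0"
      using u(2) EC[OF u(1)] by (metis eq_vecI carrier_vecD index_zero_vec)
    ultimately have ez: "exp z = exp l"
      using EC[OF u(1)] by (metis index_smult_vec(1) carrier_vecD mult_right_cancel)
    have "eigenvalue X z"
      unfolding eigenvalue_def eigenvector_def using u zu X EC[OF u(1)] shift_apply_eq_zero_iff[OF X] by auto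
    \<comment> \<open>Since \<open>l\<close> is real, the strip condition on \<open>z\<close> alone
      keeps the two imaginary parts within the range where \<open>exp\<close> is injective.\<close>
    then have "\<bar>Im z - Im l\<bar> < 2 * pi" using strip[of z] by (auto simp: l_def)
    then show "z = l" using ez by (rule exp_complex_eqI)
  qed
  \<comment> \<open>A Jordan chain of length 2 for \<open>X\<close> would give one for \<open>exp X\<close>, which is scalar on \<open>E\<close>.\<close>
  have B: "shift_apply X l u = 0\<^sub>v n" if u: "u \<in> E" and "shift_apply X l (shift_apply X l u) = 0\<^sub>v n" for u
  proof -
    note Cu = EC[OF u] and Cs = shift_apply_carrier[OF X EC[OF u], of l]
    have "exp l \<cdot>\<^sub>v u = exp l \<cdot>\<^sub>v (u + shift_apply X l u)"
      using rank2[OF Cu that(2)] u by (simp add: E_def)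
    then have "exp l * u $ i = exp l * (u $ i + shift_apply X l u $ i)" if "i < n" for i
      using that Cu Cs by (metis carrier_vecD index_add_vec(1) index_smult_vec(1) index_add_vec(2))
    then show ?thesis using Cs by (intro eq_vecI) (simp_all add: distrib_left)
  qed
  \<comment> \<open>Hence a linear factor of any product annihilating \<open>E\<close> either is \<open>X - l\<close> or is injective on \<open>E\<close>.\<close>
  have C: "shift_apply X l u = 0\<^sub>v n" if u: "u \<in> E" and "shift_apply X l (shift_apply X z u) = 0\<^sub>v n" for z u
  proof (cases "z = l")
    case True
    then show ?thesis using B[OF u] that(2) by simp
  next
    case False
    have "shift_apply X z (shift_apply X l u) = 0\<^sub>v n"
      using that(2) shift_apply_commute[OF X EC[OF u], of l z] by simp
    then show ?thesis using A[OF ED[OF u, of l], of z] False by blast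
  qed
  \<comment> \<open>The head of the list acts on \<open>u\<close> first, so the induction hypothesis
    is applied to \<open>shift_apply X z u\<close>, again a vector of \<open>E\<close>; then
    \<open>C\<close> removes the factor of \<open>z\<close>.\<close>
  have D: "shift_apply X l u = 0\<^sub>v n"
    if "u \<in> E" "shift_apply X l (fold (shift_apply X) zs u) = 0\<^sub>v n" for zs u
    using that
  proof (induction zs arbitrary: u)
    case (Cons z zs)
    then have "shift_apply X l (shift_apply X z u) = 0\<^sub>v n" using ED by simp
    then show ?case using C Cons.prems by blast
  qed simp
  obtain zs where zs: "\<And>u. u \<in> carrier_vec n \<Longrightarrow> fold (shift_apply X) zs u = 0\<^sub>v n"
    using fold_shift_apply_zero[OF X] by blast
  have "shift_apply X l v = 0\<^sub>v n"
    using D[of v zs] zs[OF v] v ev X by (simp add: E_def el)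
  then show ?thesis using shift_apply_eq_zero_iff[OF X v] by (simp add: l_def)
qed

subsection \<open>Diagonalization\<close>

lemma kernel_dim_cong:
  assumes "mat_kernel A = mat_kernel B" "dim_col A = dim_col B"
  shows "kernel_dim A = kernel_dim B"
  unfolding kernel_dim_def assms ..

lemma char_matrix_mult_vec:
  assumes "A \<in> carrier_mat n n" "u \<in> carrier_vec n"
  shows "char_matrix A z *\<^sub>v u = shift_apply A z u"
proof -
  have "char_matrix A z *\<^sub>v u = A *\<^sub>v u + (- z) \<cdot>\<^sub>m 1\<^sub>m n *\<^sub>v u"
    unfolding char_matrix_def using assms by (subst add_mult_distrib_mat_vec[of _ n n]) auto
  also have "(- z) \<cdot>\<^sub>m 1\<^sub>m n *\<^sub>v u = (- z) \<cdot>\<^sub>v u"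
    using assms by (intro eq_vecI) auto
  finally show ?thesis using assms unfolding shift_apply_def by (intro eq_vecI) auto
qed

text \<open>Splitting off the first block, of size one, leaves zero borders and shifts both
  remaining indices by one.\<close>

lemma diagonal_jordan_matrix:
  fixes n_as :: "(nat \<times> 'a :: {zero, one}) list"
  assumes "\<And>m a. (m, a) \<in> set n_as \<Longrightarrow> m = 1"
    and "i < sum_list (map fst n_as)" "j < sum_list (map fst n_as)" "i \<noteq> j"
  shows "jordan_matrix n_as $$ (i, j) = 0"
  using assms
proof (induction n_as arbitrary: i j)
  case (Cons na n_as)
  obtain a where na: "na = (1, a)" using Cons.prems(1) by (cases na) auto
  have *: "jordan_matrix (na # n_as) = four_block_mat (jordan_block 1 a)
      (0\<^sub>m 1 (sum_list (map fst n_as))) (0\<^sub>m (sum_list (map fst n_as)) 1) (jordan_matrix n_as)"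
    using jordan_matrix_dim[of n_as] by (simp add: na jordan_matrix_def Let_def)
  show ?case
  proof (cases "i = 0 \<or> j = 0")
    case True
    then show ?thesis unfolding * using Cons.prems na by auto
  next
    case False
    have "jordan_matrix n_as $$ (i - 1, j - 1) = 0"
      using Cons.prems False na by (intro Cons.IH) (force, auto)
    then show ?thesis unfolding * using Cons.prems False na by auto
  qed
qed simp

text \<open>The kernel of the k-th power of A - z has dimension the sum of min(k, m) over the Jordan
  blocks of size m for \<open>z\<close>. Equal kernels for k = 1 and k = 2 therefore rule out blocks
  of size at least two, and the Jordan form is diagonal.\<close>

lemma diagonalizable_if_no_generalized_eigenvectors:
  fixes A :: "complex mat"
  assumes A: "A \<in> carrier_mat n n"
    and ss: "\<And>z u. u \<in> carrier_vec n \<Longrightarrow> shift_apply A z (shift_apply A z u) = 0\<^sub>v n \<Longrightarrow>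
               shift_apply A z u = 0\<^sub>v n"
  obtains P Q f where "similar_mat_wit A (mat n n (\<lambda>(i, j). if i = j then f i else 0)) P Q"
proof -
  from char_poly_factorized[OF A] jordan_nf_exists[OF A] obtain n_as where jnf: "jordan_nf A n_as"
    by blast
  have kernels: "mat_kernel (char_matrix A z ^\<^sub>m 2) = mat_kernel (char_matrix A z ^\<^sub>m 1)" for z
  proof -
    have C: "char_matrix A z \<in> carrier_mat n n" using A by simp
    have sq: "char_matrix A z * char_matrix A z *\<^sub>v u = shift_apply A z (shift_apply A z u)"
      if u: "u \<in> carrier_vec n" for u
      unfolding assoc_mult_mat_vec[OF C C u] char_matrix_mult_vec[OF A u]
      by (rule char_matrix_mult_vec[OF A shift_apply_carrier[OF A u]])
    have "(char_matrix A z * char_matrix A z *\<^sub>v u = 0\<^sub>v n) = (char_matrix A z *\<^sub>v u = 0\<^sub>v n)"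
      if u: "u \<in> carrier_vec n" for u
      unfolding sq[OF u] char_matrix_mult_vec[OF A u] using ss[OF u] A by auto
    then have "mat_kernel (char_matrix A z * char_matrix A z) = mat_kernel (char_matrix A z)"
      unfolding mat_kernel[OF C] mat_kernel[OF mult_carrier_mat[OF C C]] by blast
    moreover have "char_matrix A z ^\<^sub>m 2 = char_matrix A z * char_matrix A z"
      "char_matrix A z ^\<^sub>m 1 = char_matrix A z"
      using C by (simp_all add: numeral_2_eq_2)
    ultimately show ?thesis by simp
  qed
  have blocks: "m = 1" if "(m, z) \<in> set n_as" for m z
  proof (rule ccontr)
    assume "m \<noteq> 1"
    moreover have "m \<noteq> 0" using jnf that unfolding jordan_nf_def by force
    ultimately have m: "m \<ge> 2" by simp
    define ms where "ms = map fst [(m, e)\<leftarrow>n_as. e = z]"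
    have mem: "m \<in> set ms" using that unfolding ms_def by force
    have "dim_gen_eigenspace A z 1 = dim_gen_eigenspace A z 2"
      unfolding dim_gen_eigenspace_def using kernels[of z] A
      by (intro kernel_dim_cong) auto
    then have "(\<Sum>k\<leftarrow>ms. min 1 k) = (\<Sum>k\<leftarrow>ms. min 2 k)"
      unfolding dim_gen_eigenspace[OF jnf] ms_def .
    moreover from split_list[OF mem] obtain ys zs where "ms = ys @ m # zs" by blast
    moreover have "(\<Sum>k\<leftarrow>ks. min 1 k) \<le> (\<Sum>k\<leftarrow>ks. min 2 (k :: nat))" for ks
      by (intro sum_list_mono) auto
    from this[of ys] this[of zs] have
      "(\<Sum>k\<leftarrow>ys @ m # zs. min 1 k) < (\<Sum>k\<leftarrow>ys @ m # zs. min 2 k)"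
      using m by simp
    ultimately show False by simp
  qed
  obtain P Q where PQ: "similar_mat_wit A (jordan_matrix n_as) P Q"
    using jnf unfolding jordan_nf_def similar_mat_def by blast
  have J: "jordan_matrix n_as \<in> carrier_mat n n" using similar_mat_witD2(5)[OF A PQ] .
  have s: "sum_list (map fst n_as) = n" using carrier_matD(1)[OF J] by simp
  have "jordan_matrix n_as
      = mat n n (\<lambda>(i, j). if i = j then jordan_matrix n_as $$ (i, i) else 0)"
    (is "_ = ?D")
  proof (rule eq_matI)
    fix i j assume "i < dim_row ?D" "j < dim_col ?D"
    then have ij: "i < n" "j < n" by simp_all
    show "jordan_matrix n_as $$ (i, j) = ?D $$ (i, j)"
      using diagonal_jordan_matrix[of n_as i j] blocks ij s by (cases "i = j") auto
  qed (use carrier_matD[OF J] in simp_all)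
  with PQ show thesis using that[of "\<lambda>i. jordan_matrix n_as $$ (i, i)" P Q] by simp
qed

lemma mat_eq_if_unit_vec_eq:
  fixes A B :: "'a :: comm_ring_1 mat"
  assumes "A \<in> carrier_mat n n" "B \<in> carrier_mat n n"
    and eq: "\<And>j. j < n \<Longrightarrow> A *\<^sub>v unit_vec n j = B *\<^sub>v unit_vec n j"
  shows "A = B"
proof (rule eq_matI)
  fix i j assume ij: "i < dim_row B" "j < dim_col B"
  have "(C *\<^sub>v unit_vec n j) $ i = C $$ (i, j)" if "C \<in> carrier_mat n n" for C :: "'a mat"
    using mult_mat_vec_index[OF that unit_vec_carrier, of i j] ij assms(1,2)
    by (simp add: if_distrib[of "(*) _"] cong: if_cong)
  then show "A $$ (i, j) = B $$ (i, j)"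
    using eq[of j] ij assms(1,2) by (metis carrier_matD(2))
qed (use assms in auto)

subsection \<open>Positive definite matrices\<close>

lemma cscalar_prod_sum:
  fixes v w :: "complex vec"
  assumes "v \<in> carrier_vec n" "w \<in> carrier_vec n"
  shows "v \<bullet>c w = (\<Sum>i<n. v $ i * cnj (w $ i))"
  using assms by (auto simp: scalar_prod_def lessThan_atLeast0 intro!: sum.cong)

lemma cscalar_prod_shift:
  fixes A :: "complex mat"
  assumes A: "A \<in> carrier_mat n n" and v: "v \<in> carrier_vec n" and w: "w \<in> carrier_vec n"
    and herm: "\<And>i j. i < n \<Longrightarrow> j < n \<Longrightarrow> A $$ (i, j) = cnj (A $$ (j, i))"
  shows "(A *\<^sub>v v) \<bullet>c w = v \<bullet>c (A *\<^sub>v w)"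
proof -
  have "(A *\<^sub>v v) \<bullet>c w = (\<Sum>i<n. \<Sum>j<n. A $$ (i, j) * v $ j * cnj (w $ i))"
    unfolding cscalar_prod_sum[OF mult_mat_vec_carrier[OF A v] w]
    using mult_mat_vec_index[OF A v] by (simp add: sum_distrib_right del: index_mult_mat_vec)
  also have "\<dots> = (\<Sum>j<n. \<Sum>i<n. A $$ (i, j) * v $ j * cnj (w $ i))" by (rule sum.swap)
  also have "\<dots> = (\<Sum>j<n. \<Sum>i<n. v $ j * cnj (A $$ (j, i) * w $ i))"
  proof (intro sum.cong refl)
    fix i j assume "j \<in> {..<n}" "i \<in> {..<n}"
    then have h: "A $$ (i, j) = cnj (A $$ (j, i))" using herm[of i j] by simp
    show "A $$ (i, j) * v $ j * cnj (w $ i) = v $ j * cnj (A $$ (j, i) * w $ i)"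
      unfolding h by simp
  qed
  also have "\<dots> = v \<bullet>c (A *\<^sub>v w)"
    unfolding cscalar_prod_sum[OF v mult_mat_vec_carrier[OF A w]]
    using mult_mat_vec_index[OF A w] by (simp add: sum_distrib_left del: index_mult_mat_vec)
  finally show ?thesis .
qed

text \<open>Hermitian symmetry makes the quadratic form real; taking \<open>Re\<close> states its
  positivity as an inequality between reals.\<close>

definition pos_def :: "nat \<Rightarrow> complex mat \<Rightarrow> bool" where
  "pos_def n A \<longleftrightarrow> A \<in> carrier_mat n n \<and>
     (\<forall>i<n. \<forall>j<n. A $$ (i, j) = cnj (A $$ (j, i))) \<and>
     (\<forall>v\<in>carrier_vec n. v \<noteq> 0\<^sub>v n \<longrightarrow> Re ((A *\<^sub>v v) \<bullet>c v) > 0)"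

lemma cscalar_prod_self:
  fixes v :: "complex vec"
  assumes "v \<in> carrier_vec n"
  shows "v \<bullet>c v = complex_of_real (\<Sum>i<n. (cmod (v $ i))\<^sup>2)"
  unfolding cscalar_prod_sum[OF assms assms] by (simp only: complex_norm_square of_real_sum)

text \<open>For an eigenvector \<open>v\<close>, moving \<open>A\<close> across the inner product
  equates \<open>z\<close> and \<open>cnj z\<close> times the squared norm of \<open>v\<close>, so
  \<open>z\<close> is real. Positivity of the form gives its sign.\<close>

lemma pos_def_eigenvalue:
  assumes pd: "pos_def n A" and ev: "eigenvalue A z"
  obtains x where "z = complex_of_real x" "x > 0"
proof -
  have A: "A \<in> carrier_mat n n" using pd by (simp add: pos_def_def)
  obtain v where v: "v \<in> carrier_vec n" "v \<noteq> 0\<^sub>v n" "A *\<^sub>v v = z \<cdot>\<^sub>v v"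
    using ev A unfolding eigenvalue_def eigenvector_def by auto
  define s where "s = (\<Sum>i<n. (cmod (v $ i))\<^sup>2)"
  have s: "v \<bullet>c v = complex_of_real s" unfolding s_def by (rule cscalar_prod_self[OF v(1)])
  have l: "(A *\<^sub>v v) \<bullet>c v = z * s" unfolding v(3) using v(1) s by simp
  have r: "v \<bullet>c (A *\<^sub>v v) = cnj z * s" unfolding v(3) using v(1) s by (simp add: conjugate_smult_vec)
  have "s \<ge> 0" unfolding s_def by (intro sum_nonneg) auto
  moreover have pos: "Re (z * s) > 0" using pd v(1,2) l unfolding pos_def_def by metis
  ultimately have "Re z > 0" by (simp add: zero_less_mult_iff)
  moreover have "z * s = cnj z * s"
    using cscalar_prod_shift[OF A v(1,1)] pd l r unfolding pos_def_def by metis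
  then have "z = cnj z" using pos by auto
  then have "z = complex_of_real (Re z)" by (simp add: complex_eq_iff)
  ultimately show thesis using that by blast
qed

text \<open>With w = (A - z) u and z real, self-adjointness gives <w, w> = <u, (A - z) w> =
  0.\<close>

lemma pos_def_no_generalized_eigenvectors:
  assumes pd: "pos_def n A" and u: "u \<in> carrier_vec n"
    and z: "shift_apply A z (shift_apply A z u) = 0\<^sub>v n"
  shows "shift_apply A z u = 0\<^sub>v n"
proof (rule ccontr)
  assume nz: "shift_apply A z u \<noteq> 0\<^sub>v n"
  have A: "A \<in> carrier_mat n n" using pd by (simp add: pos_def_def)
  define w where "w = shift_apply A z u"
  have w: "w \<in> carrier_vec n" unfolding w_def using A u by simp
  have Aw: "A *\<^sub>v w = z \<cdot>\<^sub>v w" using z shift_apply_eq_zero_iff[OF A w] by (simp add: w_def)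
  then have "eigenvalue A z"
    unfolding eigenvalue_def eigenvector_def using A w nz w_def by auto
  then obtain x where x: "z = complex_of_real x" using pos_def_eigenvalue[OF pd] by blast
  have "w \<bullet>c w = (A *\<^sub>v u) \<bullet>c w - (z \<cdot>\<^sub>v u) \<bullet>c w"
    using A u w by (subst (1) w_def) (simp add: shift_apply_def minus_scalar_prod_distrib[of _ n])
  also have "(A *\<^sub>v u) \<bullet>c w = u \<bullet>c (A *\<^sub>v w)"
    using cscalar_prod_shift[OF A u w] pd unfolding pos_def_def by metis
  also have "\<dots> - (z \<cdot>\<^sub>v u) \<bullet>c w = 0"
    unfolding Aw using u w by (simp add: conjugate_smult_vec x)
  finally show False using w nz by (simp add: w_def[symmetric])
qed

section \<open>Diagonal similarity and the principal logarithm\<close>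

text \<open>\<open>P *\<^sub>v unit_vec n j\<close> is the \<open>j\<close>-th column of
  \<open>P\<close>. These columns form the eigenbasis on which matrices are compared below.\<close>

lemma similar_diagonal_eigenvector:
  fixes A :: "'a :: field mat"
  assumes sim: "similar_mat_wit A (mat n n (\<lambda>(i, j). if i = j then f i else 0)) P Q"
    and A: "A \<in> carrier_mat n n" and j: "j < n"
  shows "eigenvector A (P *\<^sub>v unit_vec n j) (f j)"
proof -
  define D where "D = mat n n (\<lambda>(i, j). if i = j then f i else 0)"
  note w = similar_mat_witD2[OF A sim[folded D_def]]
  let ?u = "unit_vec n j :: 'a vec"
  have Pu: "P *\<^sub>v ?u \<in> carrier_vec n" using w(6) by simp
  have QP: "Q *\<^sub>v (P *\<^sub>v ?u) = ?u"
    using assoc_mult_mat_vec[OF w(7,6) unit_vec_carrier] w(2) by simp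
  have "D *\<^sub>v ?u = f j \<cdot>\<^sub>v ?u"
    using j by (intro eq_vecI) (auto simp: D_def)
  then have "A *\<^sub>v (P *\<^sub>v ?u) = P *\<^sub>v (f j \<cdot>\<^sub>v ?u)"
    unfolding w(3) assoc_mult_mat_vec[OF mult_carrier_mat[OF w(6,5)] w(7) Pu] QP
      assoc_mult_mat_vec[OF w(6,5) unit_vec_carrier] by simp
  also have "\<dots> = f j \<cdot>\<^sub>v (P *\<^sub>v ?u)" by (rule mult_mat_vec[OF w(6) unit_vec_carrier])
  finally have "A *\<^sub>v (P *\<^sub>v ?u) = f j \<cdot>\<^sub>v (P *\<^sub>v ?u)" .
  moreover have "P *\<^sub>v ?u \<noteq> 0\<^sub>v n"
  proof
    assume "P *\<^sub>v ?u = 0\<^sub>v n"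
    then have "?u = Q *\<^sub>v 0\<^sub>v n" using QP by simp
    also have "\<dots> = 0\<^sub>v n" using w(7) by auto
    finally show False using j by simp
  qed
  ultimately show ?thesis unfolding eigenvector_def using Pu carrier_matD(1)[OF A] by simp
qed

lemma eq_if_eq_on_similarity_columns:
  fixes X Y :: "'a :: comm_ring_1 mat"
  assumes X: "X \<in> carrier_mat n n" and Y: "Y \<in> carrier_mat n n"
    and P: "P \<in> carrier_mat n n" and Q: "Q \<in> carrier_mat n n" and PQ: "P * Q = 1\<^sub>m n"
    and eq: "\<And>j. j < n \<Longrightarrow> X *\<^sub>v (P *\<^sub>v unit_vec n j) = Y *\<^sub>v (P *\<^sub>v unit_vec n j)"
  shows "X = Y"
proof -
  have "X * P = Y * P"
  proof (rule mat_eq_if_unit_vec_eq)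
    show "X * P *\<^sub>v unit_vec n j = Y * P *\<^sub>v unit_vec n j" if "j < n" for j
      unfolding assoc_mult_mat_vec[OF X P unit_vec_carrier] assoc_mult_mat_vec[OF Y P unit_vec_carrier]
      by (rule eq[OF that])
  qed (use mult_carrier_mat[OF X P] mult_carrier_mat[OF Y P] in auto)
  then have "X * (P * Q) = Y * (P * Q)"
    using assoc_mult_mat[OF X P Q] assoc_mult_mat[OF Y P Q] by simp
  then show ?thesis using X Y by (simp add: PQ)
qed

text \<open>In the coordinates given by \<open>Q\<close>, the eigenvalue equation reads f i = z at
  every nonzero coordinate of the eigenvector.\<close>

lemma similar_diagonal_eigenvalue:
  fixes A :: "'a :: field mat"
  assumes sim: "similar_mat_wit A (mat n n (\<lambda>(i, j). if i = j then f i else 0)) P Q"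
    and A: "A \<in> carrier_mat n n" and ev: "eigenvalue A z"
  shows "z \<in> f ` {..<n}"
proof -
  define D where "D = mat n n (\<lambda>(i, j). if i = j then f i else 0)"
  note w = similar_mat_witD2[OF A sim[folded D_def]]
  obtain v where v: "v \<in> carrier_vec n" "v \<noteq> 0\<^sub>v n" "A *\<^sub>v v = z \<cdot>\<^sub>v v"
    using ev carrier_matD(1)[OF A] unfolding eigenvalue_def eigenvector_def by auto
  have Qv: "Q *\<^sub>v v \<in> carrier_vec n" using w(7) v(1) by simp
  have PQv: "P *\<^sub>v (Q *\<^sub>v v) = v"
    using assoc_mult_mat_vec[OF w(6,7) v(1)] w(1) v(1) by simp
  have "Q *\<^sub>v v \<noteq> 0\<^sub>v n"
  proof
    assume "Q *\<^sub>v v = 0\<^sub>v n"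
    then have "v = P *\<^sub>v 0\<^sub>v n" using PQv by simp
    also have "\<dots> = 0\<^sub>v n" using w(6) by auto
    finally show False using v(2) by simp
  qed
  then obtain i where i: "i < n" "(Q *\<^sub>v v) $ i \<noteq> 0"
    using Qv by (metis eq_vecI carrier_vecD index_zero_vec)
  have DQ: "D *\<^sub>v (Q *\<^sub>v v) \<in> carrier_vec n" using w(5) Qv by simp
  have "A *\<^sub>v v = P *\<^sub>v (D *\<^sub>v (Q *\<^sub>v v))"
    unfolding w(3) assoc_mult_mat_vec[OF mult_carrier_mat[OF w(6,5)] w(7) v(1)]
    by (rule assoc_mult_mat_vec[OF w(6,5) Qv])
  then have "Q *\<^sub>v (A *\<^sub>v v) = D *\<^sub>v (Q *\<^sub>v v)"
    using assoc_mult_mat_vec[OF w(7,6) DQ] DQ w(2) by simp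
  moreover have "Q *\<^sub>v (A *\<^sub>v v) = z \<cdot>\<^sub>v (Q *\<^sub>v v)"
    unfolding v(3) by (rule mult_mat_vec[OF w(7) v(1)])
  ultimately have "(D *\<^sub>v (Q *\<^sub>v v)) $ i = z * (Q *\<^sub>v v) $ i"
    using i Qv by (metis carrier_vecD index_smult_vec(1))
  moreover have "(D *\<^sub>v (Q *\<^sub>v v)) $ i = f i * (Q *\<^sub>v v) $ i"
    unfolding mult_mat_vec_index[OF w(5) Qv i(1)] using i(1)
    by (simp add: D_def if_distrib[of "\<lambda>x. x * _"] cong: if_cong del: index_mult_mat_vec)
  ultimately show ?thesis using i by auto
qed

text \<open>Existence and uniqueness are both required to evaluate the \<open>THE\<close> in
  \<open>principal_ln\<close>. The candidate \<open>Y\<close> takes real logarithms of the positive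
  eigenvalues in an eigenbasis of \<open>A\<close>. Any other candidate has to act by the same
  scalars on that basis.\<close>

lemma pos_def_is_principal_ln:
  assumes pd: "pos_def n A"
  shows "is_principal_ln A (principal_ln A)"
proof -
  have A: "A \<in> carrier_mat n n" using pd by (simp add: pos_def_def)
  obtain P Q f where sim: "similar_mat_wit A (mat n n (\<lambda>(i, j). if i = j then f i else 0)) P Q"
    by (rule diagonalizable_if_no_generalized_eigenvectors[OF A
          pos_def_no_generalized_eigenvectors[OF pd]])
  note w = similar_mat_witD2[OF A sim]
  have Pu: "P *\<^sub>v unit_vec n j \<in> carrier_vec n" for j using w(6) by simp
  have Aev: "A *\<^sub>v (P *\<^sub>v unit_vec n j) = f j \<cdot>\<^sub>v (P *\<^sub>v unit_vec n j)" if "j < n" for j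
    using similar_diagonal_eigenvector[OF sim A that] by (simp add: eigenvector_def)
  have pos: "f j = complex_of_real (Re (f j)) \<and> Re (f j) > 0" if "j < n" for j
  proof -
    have "eigenvalue A (f j)"
      using similar_diagonal_eigenvector[OF sim A that] unfolding eigenvalue_def by blast
    then show ?thesis using pos_def_eigenvalue[OF pd] by fastforce
  qed
  define g where "g j = complex_of_real (ln (Re (f j)))" for j
  define D where "D = mat n n (\<lambda>(i, j). if i = j then g i else 0)"
  define Y where "Y = P * D * Q"
  have D: "D \<in> carrier_mat n n" by (simp add: D_def)
  have Y: "Y \<in> carrier_mat n n" unfolding Y_def using w(6,7) D by (intro mult_carrier_mat)
  have simY: "similar_mat_wit Y D P Q" by (rule similar_mat_witI[OF w(1,2) Y_def Y D w(6,7)])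
  have Yev: "Y *\<^sub>v (P *\<^sub>v unit_vec n j) = g j \<cdot>\<^sub>v (P *\<^sub>v unit_vec n j)" if "j < n" for j
    using similar_diagonal_eigenvector[OF simY[unfolded D_def] Y that] by (simp add: eigenvector_def)
  have "mat_exp Y = A"
  proof (rule eq_if_eq_on_similarity_columns[OF mat_exp_carrier[OF Y] A w(6,7,1)])
    fix j assume j: "j < n"
    have "exp (g j) = f j" using pos[OF j] unfolding g_def by (simp add: exp_of_real)
    then show "mat_exp Y *\<^sub>v (P *\<^sub>v unit_vec n j) = A *\<^sub>v (P *\<^sub>v unit_vec n j)"
      using mat_exp_eigenvector[OF Y Pu Yev[OF j]] Aev[OF j] by simp
  qed
  moreover have "- pi < Im z \<and> Im z < pi" if "eigenvalue Y z" for z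
    using similar_diagonal_eigenvalue[OF simY[unfolded D_def] Y that] by (auto simp: g_def)
  ultimately have "is_principal_ln A Y"
    unfolding is_principal_ln_def using Y carrier_matD(1)[OF A] by simp
  moreover have "X = Y" if "is_principal_ln A X" for X
  proof -
    have X: "X \<in> carrier_mat n n" "mat_exp X = A"
      "\<And>z. eigenvalue X z \<Longrightarrow> - pi < Im z \<and> Im z < pi"
      using that carrier_matD(1)[OF A] unfolding is_principal_ln_def by auto
    show ?thesis
    proof (rule eq_if_eq_on_similarity_columns[OF X(1) Y w(6,7,1)])
      fix j assume j: "j < n"
      have "mat_exp X *\<^sub>v (P *\<^sub>v unit_vec n j) = complex_of_real (Re (f j)) \<cdot>\<^sub>v (P *\<^sub>v unit_vec n j)"
        using Aev[OF j] pos[OF j] X(2) by simp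
      from principal_log_eigenvector[OF X(1,3) Pu this] pos[OF j]
      show "X *\<^sub>v (P *\<^sub>v unit_vec n j) = Y *\<^sub>v (P *\<^sub>v unit_vec n j)"
        using Yev[OF j] by (simp add: g_def)
    qed
  qed
  ultimately show ?thesis unfolding principal_ln_def by (rule theI)
qed

lemma pos_def_principal_ln_eigenvector:
  assumes pd: "pos_def n A" and ev: "eigenvector A v (complex_of_real x)"
  shows "eigenvector (principal_ln A) v (complex_of_real (ln x))" "x > 0"
proof -
  have A: "A \<in> carrier_mat n n" using pd by (simp add: pos_def_def)
  have "eigenvalue A (complex_of_real x)" using ev unfolding eigenvalue_def by blast
  then show x: "x > 0" using pos_def_eigenvalue[OF pd] by fastforce
  have L: "principal_ln A \<in> carrier_mat n n" "mat_exp (principal_ln A) = A"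
    "\<And>z. eigenvalue (principal_ln A) z \<Longrightarrow> - pi < Im z \<and> Im z < pi"
    using pos_def_is_principal_ln[OF pd] carrier_matD(1)[OF A] unfolding is_principal_ln_def by auto
  have v: "v \<in> carrier_vec n" "v \<noteq> 0\<^sub>v n" "A *\<^sub>v v = complex_of_real x \<cdot>\<^sub>v v"
    using ev carrier_matD(1)[OF A] by (auto simp: eigenvector_def)
  have "principal_ln A *\<^sub>v v = complex_of_real (ln x) \<cdot>\<^sub>v v"
    using principal_log_eigenvector[OF L(1,3) v(1) _ x] v(3) L(2) by simp
  then show "eigenvector (principal_ln A) v (complex_of_real (ln x))"
    using v(1,2) carrier_matD(1)[OF L(1)] by (simp add: eigenvector_def)
qed

subsection \<open>Means of exponentials of group Laplacians\<close>

text \<open>All positive powers of \<open>M\<close> are multiples of \<open>M\<close>, so the series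
  collapses to a scalar exponential series apart from its constant term.\<close>

lemma mat_exp_smult_of_quasi_idempotent:
  fixes M :: "real mat"
  assumes M: "M \<in> carrier_mat n n" and MM: "M * M = c \<cdot>\<^sub>m M" and c: "c \<noteq> 0"
  shows "mat_exp (t \<cdot>\<^sub>m M) = 1\<^sub>m n + alpha c t \<cdot>\<^sub>m M"
proof (rule eq_matI)
  fix i j assume "i < dim_row (1\<^sub>m n + alpha c t \<cdot>\<^sub>m M)" "j < dim_col (1\<^sub>m n + alpha c t \<cdot>\<^sub>m M)"
  then have ij: "i < n" "j < n" using M by auto
  have pow: "(t \<cdot>\<^sub>m M) ^\<^sub>m Suc k = (t ^ Suc k * c ^ k) \<cdot>\<^sub>m M" for k
  proof (induction k)
    case 0
    then show ?case using M by simp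
  next
    case (Suc k)
    have "(t \<cdot>\<^sub>m M) ^\<^sub>m Suc (Suc k) = ((t ^ Suc k * c ^ k) \<cdot>\<^sub>m M) * (t \<cdot>\<^sub>m M)"
      using Suc by simp
    also have "\<dots> = (t ^ Suc k * c ^ k) \<cdot>\<^sub>m (t \<cdot>\<^sub>m (c \<cdot>\<^sub>m M))"
      using mult_smult_assoc_mat[OF M smult_carrier_mat[OF M]] mult_smult_distrib[OF M M] MM by simp
    also have "\<dots> = (t ^ Suc (Suc k) * c ^ Suc k) \<cdot>\<^sub>m M"
      using M by (intro eq_matI) auto
    finally show ?case .
  qed
  \<comment> \<open>Dividing by \<open>c\<close> replaces c^(k-1) times the entry by c^k times
    \<open>x\<close>. The same formula then covers \<open>k = 0\<close> up to a correction, since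
    the zeroth power is the identity.\<close>
  define x where "x = M $$ (i, j) / c"
  have term_eq: "((t \<cdot>\<^sub>m M) ^\<^sub>m k) $$ (i, j) / fact k
      = (c * t) ^ k / fact k * x + (if k = 0 then (1\<^sub>m n) $$ (i, j) - x else 0)" for k
  proof (cases k)
    case 0
    then show ?thesis using M ij by simp
  next
    case (Suc k')
    then show ?thesis unfolding Suc pow using M ij c by (simp add: x_def power_mult_distrib field_simps)
  qed
  have "(\<lambda>k. (c * t) ^ k / fact k) sums exp (c * t)"
    using exp_converges[of "c * t"] by (simp add: divide_inverse mult.commute)
  then have "(\<lambda>k. ((t \<cdot>\<^sub>m M) ^\<^sub>m k) $$ (i, j) / fact k) sums (exp (c * t) * x + ((1\<^sub>m n) $$ (i, j) - x))"
    unfolding term_eq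
    using sums_If_finite_set[of "{0}" "\<lambda>_. (1\<^sub>m n) $$ (i, j) - x"] by (intro sums_add sums_mult2) simp_all
  then have "mat_exp (t \<cdot>\<^sub>m M) $$ (i, j) = exp (c * t) * x + ((1\<^sub>m n) $$ (i, j) - x)"
    using M ij by (simp add: mat_exp_def sums_iff)
  also have "\<dots> = (1\<^sub>m n + alpha c t \<cdot>\<^sub>m M) $$ (i, j)"
    using M ij c by (simp add: alpha_def x_def field_simps)
  finally show "mat_exp (t \<cdot>\<^sub>m M) $$ (i, j) = (1\<^sub>m n + alpha c t \<cdot>\<^sub>m M) $$ (i, j)" .
qed (use M in \<open>auto simp: mat_exp_def\<close>)

section \<open>Group Laplacians\<close>

lemma pairwise_laplacian_carrier [simp]: "pairwise_laplacian N d g \<in> carrier_mat N N"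
  by (simp add: pairwise_laplacian_def)

text \<open>On \<open>g\<close> the Laplacian is d I - J with J the all-ones matrix; writing the
  entries this way lets sums over \<open>g\<close> split.\<close>

lemma pairwise_laplacian_index:
  assumes "i < N" "j < N"
  shows "pairwise_laplacian N d g $$ (i, j)
    = (if i \<in> g \<and> j \<in> g then (if i = j then real d else 0) - 1 else 0)"
  using assms by (simp add: pairwise_laplacian_def)

lemma sum_lessThan_restrict:
  fixes f :: "nat \<Rightarrow> 'a :: comm_monoid_add"
  assumes "g \<subseteq> {0..<N}"
  shows "(\<Sum>i<N. if i \<in> g then f i else 0) = sum f g"
proof -
  have "{..<N} \<inter> g = g" using assms by auto
  then show ?thesis by (simp add: sum.inter_restrict[symmetric])
qed

text \<open>On \<open>g\<close>, J^2 = d J, hence (d I - J)^2 = d^2 I - 2 d J + d J = d (d I -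
  J).\<close>

lemma pairwise_laplacian_square:
  assumes g: "d_group N d g"
  shows "pairwise_laplacian N d g * pairwise_laplacian N d g = real d \<cdot>\<^sub>m pairwise_laplacian N d g"
    (is "?L * ?L = _")
proof (rule eq_matI)
  fix i j assume "i < dim_row (real d \<cdot>\<^sub>m ?L)" "j < dim_col (real d \<cdot>\<^sub>m ?L)"
  then have ij: "i < N" "j < N" by (simp_all add: pairwise_laplacian_def)
  have g': "g \<subseteq> {0..<N}" "card g = d" using g by (simp_all add: d_group_def)
  then have fin: "finite g" using finite_subset by blast
  have "(?L * ?L) $$ (i, j) = (\<Sum>k<N. ?L $$ (i, k) * ?L $$ (k, j))"
    using ij carrier_matD[OF pairwise_laplacian_carrier[of N d g]]
    by (auto simp: scalar_prod_def lessThan_atLeast0 intro!: sum.cong)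
  also have "\<dots> = (\<Sum>k<N. if k \<in> g then (if i \<in> g \<and> j \<in> g then
      ((if i = k then real d else 0) - 1) * ((if k = j then real d else 0) - 1) else 0) else 0)"
    using ij by (intro sum.cong) (auto simp: pairwise_laplacian_index)
  also have "\<dots> = (\<Sum>k\<in>g. if i \<in> g \<and> j \<in> g then
      ((if i = k then real d else 0) - 1) * ((if k = j then real d else 0) - 1) else 0)"
    by (rule sum_lessThan_restrict[OF g'(1)])
  also have "\<dots> = real d * ?L $$ (i, j)"
  proof (cases "i \<in> g \<and> j \<in> g")
    case True
    \<comment> \<open>Summed over \<open>k\<close> in \<open>g\<close>, the constant 1 gives
      \<open>card g = d\<close> and cancels one of the two contributions
      \<open>- real d\<close>.\<close>
    have "((if i = k then real d else 0) - 1) * ((if k = j then real d else 0) - 1)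
        = (if k = i then (if i = j then (real d)\<^sup>2 else 0) - real d else 0)
          - (if k = j then real d else 0) + 1" for k
      by (auto simp: power2_eq_square algebra_simps)
    then show ?thesis
      using True fin g'(2) ij
      by (simp add: pairwise_laplacian_index sum.distrib sum_subtractf power2_eq_square algebra_simps)
  next
    case False
    then show ?thesis using ij by (auto simp: pairwise_laplacian_index)
  qed
  finally show "(?L * ?L) $$ (i, j) = (real d \<cdot>\<^sub>m ?L) $$ (i, j)"
    using ij carrier_matD[OF pairwise_laplacian_carrier[of N d g]] by simp
qed (simp_all add: pairwise_laplacian_def)

section \<open>Quadratic forms of Laplacians and of their means\<close>

text \<open>The Hermitian form v* M v as an explicit double sum, which is visibly linear in the
  entries of \<open>M\<close> and so passes through \<open>mean_mat\<close>.\<close>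

definition mat_form :: "nat \<Rightarrow> complex vec \<Rightarrow> real mat \<Rightarrow> complex" where
  "mat_form N v M = (\<Sum>i<N. \<Sum>j<N. complex_of_real (M $$ (i, j)) * v $ j * cnj (v $ i))"

lemma mat_form_eq_cscalar_prod:
  assumes M: "M \<in> carrier_mat N N" and v: "v \<in> carrier_vec N"
  shows "(map_mat complex_of_real M *\<^sub>v v) \<bullet>c v = mat_form N v M"
proof -
  have C: "map_mat complex_of_real M \<in> carrier_mat N N" using M by simp
  have "(map_mat complex_of_real M *\<^sub>v v) $ i = (\<Sum>j<N. complex_of_real (M $$ (i, j)) * v $ j)"
    if "i < N" for i
    unfolding mult_mat_vec_index[OF C v that] using M that by (intro sum.cong) auto
  then show ?thesis
    unfolding cscalar_prod_sum[OF mult_mat_vec_carrier[OF C v] v] mat_form_def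
    by (simp add: sum_distrib_right del: index_mult_mat_vec)
qed

text \<open>
  The form equals \<open>d\<close> times the squared norm of \<open>v\<close> on \<open>g\<close>, minus the squared modulus of the
  sum of \<open>v\<close> over \<open>g\<close>.
\<close>

lemma Re_mat_form_pairwise_laplacian:
  assumes g: "d_group N d g"
  shows "Re (mat_form N v (pairwise_laplacian N d g)) \<le> real d * (\<Sum>i<N. (cmod (v $ i))\<^sup>2)"
proof -
  have g': "g \<subseteq> {0..<N}" using g by (simp add: d_group_def)
  then have fin: "finite g" using finite_subset by blast
  define S where "S = (\<Sum>i\<in>g. v $ i)"
  have "mat_form N v (pairwise_laplacian N d g) = (\<Sum>i<N. if i \<in> g then
      (\<Sum>j<N. if j \<in> g then ((if i = j then of_nat d else 0) - 1) * v $ j * cnj (v $ i) else 0) else 0)"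
    unfolding mat_form_def
    by (intro sum.cong refl) (auto simp: pairwise_laplacian_index intro!: sum.cong)
  also have "\<dots> = (\<Sum>i\<in>g. \<Sum>j\<in>g. ((if i = j then of_nat d else 0) - 1) * v $ j * cnj (v $ i))"
    by (simp only: sum_lessThan_restrict[OF g'])
  also have "\<dots> = (\<Sum>i\<in>g. of_nat d * (v $ i * cnj (v $ i)) - S * cnj (v $ i))"
  proof (intro sum.cong refl)
    fix i assume i: "i \<in> g"
    have "((if i = j then of_nat d else 0) - 1) * v $ j * cnj (v $ i)
        = (if j = i then of_nat d * (v $ i * cnj (v $ i)) else 0) - v $ j * cnj (v $ i)" for j
      by (simp add: algebra_simps)
    then show "(\<Sum>j\<in>g. ((if i = j then of_nat d else 0) - 1) * v $ j * cnj (v $ i))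
        = of_nat d * (v $ i * cnj (v $ i)) - S * cnj (v $ i)"
      using i fin by (simp add: sum_subtractf S_def sum_distrib_right)
  qed
  also have "\<dots> = of_nat d * (\<Sum>i\<in>g. v $ i * cnj (v $ i)) - S * cnj S"
    by (simp add: sum_subtractf sum_distrib_left S_def)
  also have "\<dots> = complex_of_real (real d * (\<Sum>i\<in>g. (cmod (v $ i))\<^sup>2) - (cmod S)\<^sup>2)"
    by (simp only: complex_norm_square of_real_sum of_real_diff of_real_mult of_real_of_nat_eq)
  finally have "Re (mat_form N v (pairwise_laplacian N d g))
      = real d * (\<Sum>i\<in>g. (cmod (v $ i))\<^sup>2) - (cmod S)\<^sup>2" by simp
  also have "\<dots> \<le> real d * (\<Sum>i\<in>g. (cmod (v $ i))\<^sup>2)" by simp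
  also have "\<dots> \<le> real d * (\<Sum>i<N. (cmod (v $ i))\<^sup>2)"
    using g' by (intro mult_left_mono sum_mono2) auto
  finally show ?thesis .
qed

lemma alpha_neg_pos: "c < 0 \<Longrightarrow> t > 0 \<Longrightarrow> alpha c t > 0"
  by (simp add: alpha_def divide_neg_neg mult_neg_pos)

lemma mult_alpha: "c \<noteq> 0 \<Longrightarrow> c * alpha c t = exp (c * t) - 1"
  by (simp add: alpha_def)

lemma mat_form_smult:
  "M \<in> carrier_mat N N \<Longrightarrow> mat_form N v (a \<cdot>\<^sub>m M) = complex_of_real a * mat_form N v M"
  by (auto simp: mat_form_def sum_distrib_left mult.assoc intro!: sum.cong)

lemma mat_form_add:
  assumes "A \<in> carrier_mat N N" "B \<in> carrier_mat N N"
  shows "mat_form N v (A + B) = mat_form N v A + mat_form N v B"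
  unfolding mat_form_def sum.distrib[symmetric]
  using assms by (intro sum.cong refl) (simp add: distrib_right)

lemma mat_form_mean:
  "mat_form N v (mean_mat N Ms) = (\<Sum>M\<in>#Ms. mat_form N v M) / of_nat (size Ms)"
proof -
  have "(\<Sum>M\<in>#Ms. mat_form N v M)
      = (\<Sum>i<N. \<Sum>j<N. complex_of_real (\<Sum>M\<in>#Ms. M $$ (i, j)) * v $ j * cnj (v $ i))"
    by (induction Ms) (simp_all add: mat_form_def sum.distrib distrib_right)
  then show ?thesis by (simp add: mat_form_def mean_mat_def sum_divide_distrib)
qed

section \<open>Aggregated and effective matrices of a family of groups\<close>

context
  \<comment> \<open>\<open>s = 1\<close> for pairwise and \<open>s = d - 2\<close> for three-way interactions\<close>
  fixes N d :: nat and s t :: real and G :: "nat set multiset" and Ms :: "real mat multiset"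
  assumes d: "d > 0" and s: "s > 0" and t: "t > 0" and G0: "G \<noteq> {#}"
    and G: "\<And>g. g \<in># G \<Longrightarrow> d_group N d g"
    and Ms: "Ms = {#(- s) \<cdot>\<^sub>m pairwise_laplacian N d g. g \<in># G#}"
begin

text \<open>All groups have the same size, so every matrix in \<open>Ms\<close> squares to the same
  multiple - s d of itself. The coefficient \<open>alpha\<close> is therefore common to all summands
  and the mean can be taken inside.\<close>

lemma mean_mat_exp_laplacians:
  "mean_mat N {#mat_exp (t \<cdot>\<^sub>m M). M \<in># Ms#} = 1\<^sub>m N + alpha (- (s * d)) t \<cdot>\<^sub>m mean_mat N Ms"
proof (rule eq_matI)
  let ?R = "1\<^sub>m N + alpha (- (s * d)) t \<cdot>\<^sub>m mean_mat N Ms"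
  fix i j assume "i < dim_row ?R" "j < dim_col ?R"
  then have ij: "i < N" "j < N" by (simp_all add: mean_mat_def)
  have "mat_exp (t \<cdot>\<^sub>m M) $$ (i, j) = (1\<^sub>m N) $$ (i, j) + alpha (- (s * d)) t * M $$ (i, j)"
    if M_in: "M \<in># Ms" for M
  proof -
    obtain g where g: "g \<in># G" and M: "M = (- s) \<cdot>\<^sub>m pairwise_laplacian N d g"
      using M_in Ms by auto
    have "M * M = (- s) \<cdot>\<^sub>m ((- s) \<cdot>\<^sub>m (real d \<cdot>\<^sub>m pairwise_laplacian N d g))"
      unfolding M pairwise_laplacian_square[OF G[OF g], symmetric]
        mult_smult_assoc_mat[OF pairwise_laplacian_carrier smult_carrier_mat[OF pairwise_laplacian_carrier]]
        mult_smult_distrib[OF pairwise_laplacian_carrier pairwise_laplacian_carrier] ..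
    also have "\<dots> = (- (s * d)) \<cdot>\<^sub>m M"
      unfolding M by (intro eq_matI) simp_all
    finally have MM: "M * M = (- (s * d)) \<cdot>\<^sub>m M" .
    have C: "M \<in> carrier_mat N N" unfolding M by (intro smult_carrier_mat pairwise_laplacian_carrier)
    show ?thesis
      using mat_exp_smult_of_quasi_idempotent[OF C MM, of t] s d C ij by simp
  qed
  then have "(\<Sum>M\<in>#Ms. mat_exp (t \<cdot>\<^sub>m M) $$ (i, j))
      = (\<Sum>M\<in>#Ms. (1\<^sub>m N) $$ (i, j) + alpha (- (s * d)) t * M $$ (i, j))"
    by (intro arg_cong[of _ _ sum_mset] image_mset_cong)
  also have "\<dots> = real (size Ms) * (1\<^sub>m N) $$ (i, j) + alpha (- (s * d)) t * (\<Sum>M\<in>#Ms. M $$ (i, j))"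
    (is "_ = ?s Ms")
  proof -
    have "(\<Sum>M\<in>#K. (1\<^sub>m N) $$ (i, j) + alpha (- (s * d)) t * M $$ (i, j)) = ?s K" for K
      by (induction K) (simp_all add: distrib_left distrib_right)
    then show ?thesis .
  qed
  finally have "(\<Sum>M\<in>#Ms. mat_exp (t \<cdot>\<^sub>m M) $$ (i, j)) = ?s Ms" .
  moreover have "Ms \<noteq> {#}" using G0 Ms by simp
  ultimately show "mean_mat N {#mat_exp (t \<cdot>\<^sub>m M). M \<in># Ms#} $$ (i, j) = ?R $$ (i, j)"
    using ij by (simp add: mean_mat_def multiset.map_comp comp_def add_divide_distrib)
qed (simp_all add: mean_mat_def)

lemma Re_mat_form_mean_laplacians:
  "Re (mat_form N v (mean_mat N Ms)) \<ge> - (s * d) * (\<Sum>i<N. (cmod (v $ i))\<^sup>2)"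
proof -
  let ?n = "\<Sum>i<N. (cmod (v $ i))\<^sup>2"
  have "Re (mat_form N v M) \<ge> - (s * d) * ?n" if M_in: "M \<in># Ms" for M
  proof -
    obtain g where g: "g \<in># G" and M: "M = (- s) \<cdot>\<^sub>m pairwise_laplacian N d g"
      using M_in Ms by auto
    have "Re (mat_form N v M) = - s * Re (mat_form N v (pairwise_laplacian N d g))"
      unfolding M mat_form_smult[OF pairwise_laplacian_carrier] by simp
    then show ?thesis
      using mult_left_mono[OF Re_mat_form_pairwise_laplacian[OF G[OF g], of v], of s] s by simp
  qed
  then have "(\<Sum>M\<in>#Ms. Re (mat_form N v M)) \<ge> (\<Sum>M\<in>#Ms. - (s * d) * ?n)"
    by (intro sum_mset_mono) simp
  moreover have "Re (\<Sum>M\<in>#Ms. mat_form N v M) = (\<Sum>M\<in>#Ms. Re (mat_form N v M))"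
    by (induction Ms) simp_all
  moreover have "size Ms > 0" using G0 Ms by (simp add: nonempty_has_size)
  ultimately show ?thesis
    unfolding mat_form_mean by (simp add: Re_divide_of_nat field_simps)
qed

text \<open>With c = - s d, the form of the aggregated matrix is at least c times the squared norm.
  Since 1 + c \<open>alpha c t\<close> = exp (c t), the form of the mean of exponentials is at least
  exp (c t) times the squared norm.\<close>

lemma pos_def_mean_mat_exp_laplacians:
  "pos_def N (map_mat complex_of_real (mean_mat N {#mat_exp (t \<cdot>\<^sub>m M). M \<in># Ms#}))"
proof -
  let ?a = "alpha (- (s * d)) t"
  let ?E = "1\<^sub>m N + ?a \<cdot>\<^sub>m mean_mat N Ms"
  have B: "mean_mat N Ms \<in> carrier_mat N N" by (simp add: mean_mat_def)
  have E: "?E \<in> carrier_mat N N" using B by simp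
  have a: "?a > 0" using alpha_neg_pos[of "- (s * d)" t] s d t by simp
  have pos: "Re (mat_form N v ?E) > 0" if v: "v \<in> carrier_vec N" "v \<noteq> 0\<^sub>v N" for v
  proof -
    let ?n = "\<Sum>i<N. (cmod (v $ i))\<^sup>2"
    obtain i where "i < N" "v $ i \<noteq> 0"
      using v by (metis eq_vecI carrier_vecD index_zero_vec)
    then have n: "?n > 0" by (intro sum_pos2[of _ i]) auto
    have "mat_form N v ?E = mat_form N v (1\<^sub>m N) + mat_form N v (?a \<cdot>\<^sub>m mean_mat N Ms)"
      by (rule mat_form_add[OF one_carrier_mat smult_carrier_mat[OF B]])
    moreover have "mat_form N v (1\<^sub>m N) = complex_of_real ?n"
    proof -
      have "map_mat complex_of_real (1\<^sub>m N) = 1\<^sub>m N" by (intro eq_matI) auto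
      then show ?thesis
        using mat_form_eq_cscalar_prod[OF one_carrier_mat v(1)] cscalar_prod_self[OF v(1)] v(1) by simp
    qed
    ultimately have form: "Re (mat_form N v ?E) = ?n + ?a * Re (mat_form N v (mean_mat N Ms))"
      by (simp add: mat_form_smult[OF B])
    have "0 < exp (- (s * d) * t) * ?n" using n by simp
    also have "\<dots> = (1 + - (s * d) * ?a) * ?n"
      using mult_alpha[of "- (s * d)" t] s d by simp
    also have "\<dots> = ?n + ?a * (- (s * d) * ?n)"
      by (simp add: algebra_simps)
    also have "\<dots> \<le> Re (mat_form N v ?E)"
      unfolding form using mult_left_mono[OF Re_mat_form_mean_laplacians[of v], of ?a] a by simp
    finally show ?thesis .
  qed
  have "mean_mat N Ms $$ (i, j) = mean_mat N Ms $$ (j, i)" if "i < N" "j < N" for i j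
  proof -
    have "M $$ (i, j) = M $$ (j, i)" if "M \<in># Ms" for M
      using that \<open>i < N\<close> \<open>j < N\<close> carrier_matD[OF pairwise_laplacian_carrier[of N d]]
      by (auto simp: Ms pairwise_laplacian_index)
    then have "(\<Sum>M\<in>#Ms. M $$ (i, j)) = (\<Sum>M\<in>#Ms. M $$ (j, i))"
      by (intro arg_cong[of _ _ sum_mset] image_mset_cong)
    then show ?thesis using that by (simp add: mean_mat_def)
  qed
  then have herm: "map_mat complex_of_real ?E $$ (i, j) = cnj (map_mat complex_of_real ?E $$ (j, i))"
    if "i < N" "j < N" for i j
    using that B by auto
  show ?thesis
    unfolding mean_mat_exp_laplacians pos_def_def
  proof (intro conjI allI ballI impI)
    show "map_mat complex_of_real ?E \<in> carrier_mat N N" using E by simp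
    show "Re ((map_mat complex_of_real ?E *\<^sub>v v) \<bullet>c v) > 0" if "v \<in> carrier_vec N" "v \<noteq> 0\<^sub>v N" for v
      unfolding mat_form_eq_cscalar_prod[OF E that(1)] by (rule pos[OF that])
  qed (rule herm)
qed

text \<open>The mean of exponentials is affine in the aggregated matrix and keeps its eigenvectors.
  The principal logarithm keeps them as well, after passing to complex vectors. Positivity of the
  argument of \<open>ln\<close> comes from positive definiteness.\<close>

lemma effective_mat_eigenvector:
  assumes ev: "eigenvector (aggregated_mat N Ms) v \<mu>"
  shows "eigenvector (effective_mat N t Ms) (map_vec complex_of_real v)
      (complex_of_real (1 / t * ln (1 + alpha (- (s * d)) t * \<mu>)))"
    and "1 + alpha (- (s * d)) t * \<mu> > 0"
proof -
  let ?a = "alpha (- (s * d)) t" and ?B = "mean_mat N Ms"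
  let ?E = "1\<^sub>m N + ?a \<cdot>\<^sub>m ?B"
  let ?A = "map_mat complex_of_real ?E" and ?v = "map_vec complex_of_real v"
  have B: "?B \<in> carrier_mat N N" by (simp add: mean_mat_def)
  have E: "?E \<in> carrier_mat N N" using B by simp
  have v: "v \<in> carrier_vec N" "v \<noteq> 0\<^sub>v N" "?B *\<^sub>v v = \<mu> \<cdot>\<^sub>v v"
    using ev carrier_matD(1)[OF B] by (auto simp: eigenvector_def aggregated_mat_def)
  have "?E *\<^sub>v v = v + ?a \<cdot>\<^sub>m ?B *\<^sub>v v"
    using B v(1) by (subst add_mult_distrib_mat_vec[of _ N N]) auto
  also have "?a \<cdot>\<^sub>m ?B *\<^sub>v v = ?a \<cdot>\<^sub>v (?B *\<^sub>v v)"
    using B v(1) by (intro eq_vecI) auto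
  also have "v + \<dots> = (1 + ?a * \<mu>) \<cdot>\<^sub>v v"
    unfolding v(3) using v(1) by (intro eq_vecI) (auto simp: algebra_simps)
  finally have "?E *\<^sub>v v = (1 + ?a * \<mu>) \<cdot>\<^sub>v v" .
  moreover have "?A *\<^sub>v ?v = map_vec complex_of_real (?E *\<^sub>v v)"
    by (rule of_real_hom.mult_mat_vec_hom[OF E v(1), symmetric])
  moreover have "map_vec complex_of_real ((1 + ?a * \<mu>) \<cdot>\<^sub>v v) = complex_of_real (1 + ?a * \<mu>) \<cdot>\<^sub>v ?v"
    by (intro eq_vecI) auto
  ultimately have "?A *\<^sub>v ?v = complex_of_real (1 + ?a * \<mu>) \<cdot>\<^sub>v ?v" by simp
  moreover have "?v \<noteq> 0\<^sub>v N"
  proof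
    assume z: "?v = 0\<^sub>v N"
    have "v $ i = 0" if "i < N" for i
      using arg_cong[OF z, of "\<lambda>w. w $ i"] that v(1) by simp
    then show False using v(1,2) by (metis eq_vecI carrier_vecD index_zero_vec)
  qed
  ultimately have evA: "eigenvector ?A ?v (complex_of_real (1 + ?a * \<mu>))"
    using v(1) B by (simp add: eigenvector_def)
  have pd: "pos_def N ?A" using pos_def_mean_mat_exp_laplacians unfolding mean_mat_exp_laplacians .
  show "1 + ?a * \<mu> > 0" by (rule pos_def_principal_ln_eigenvector(2)[OF pd evA])
  have L: "principal_ln ?A \<in> carrier_mat N N"
    using pos_def_is_principal_ln[OF pd] B unfolding is_principal_ln_def by simp
  have "eigenvector (principal_ln ?A) ?v (complex_of_real (ln (1 + ?a * \<mu>)))"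
    by (rule pos_def_principal_ln_eigenvector(1)[OF pd evA])
  then have w: "?v \<in> carrier_vec N" "?v \<noteq> 0\<^sub>v N"
    "principal_ln ?A *\<^sub>v ?v = complex_of_real (ln (1 + ?a * \<mu>)) \<cdot>\<^sub>v ?v"
    using carrier_matD(1)[OF L] by (simp_all add: eigenvector_def)
  have "complex_of_real (1 / t) \<cdot>\<^sub>m principal_ln ?A *\<^sub>v ?v
      = complex_of_real (1 / t) \<cdot>\<^sub>v (principal_ln ?A *\<^sub>v ?v)"
    using L w(1) by (intro eq_vecI) auto
  also have "\<dots> = complex_of_real (1 / t * ln (1 + ?a * \<mu>)) \<cdot>\<^sub>v ?v"
    unfolding w(3) by (simp add: smult_smult_assoc)
  finally show "eigenvector (effective_mat N t Ms) ?v (complex_of_real (1 / t * ln (1 + ?a * \<mu>)))"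
    unfolding effective_mat_def mean_mat_exp_laplacians eigenvector_def
    using w(1,2) carrier_matD(1)[OF L] by simp
qed

end

subsection \<open>Comparison of the rates\<close>

text \<open>Going from \<open>k\<close> to \<open>k + 1\<close> adds q^k (1 - q) on the left and the
  no smaller 1 - q on the right. Strictness comes from k = 2, where the difference is (1 -
  q)^2.\<close>

lemma one_minus_power_less:
  fixes q :: real
  assumes "0 \<le> q" "q < 1" "k \<ge> 2"
  shows "1 - q ^ k < real k * (1 - q)"
  using assms(3)
proof (induction k rule: dec_induct)
  case base
  have "real 2 * (1 - q) - (1 - q ^ 2) = (1 - q)\<^sup>2" by (simp add: power2_eq_square algebra_simps)
  then show ?case using assms(2) by (smt (verit) zero_less_power)
next
  case (step k)
  have "q ^ k * (1 - q) \<le> 1 * (1 - q)"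
    using assms by (intro mult_right_mono power_le_one) auto
  then show ?case using step.IH by (simp add: algebra_simps)
qed

lemma alpha_threeway_less_pairwise:
  assumes "d > 3" "t > 0"
  shows "alpha (- (real d * (real d - 2))) t < alpha (- real d) t"
proof -
  define q where "q = exp (- real d * t)"
  have q: "0 \<le> q" "q < 1" using assms by (simp_all add: q_def)
  \<comment> \<open>The three-way decay factor is the pairwise one to the power
    \<open>d - 2\<close>; as \<open>d > 3\<close>, the natural subtraction is exact and the power is
    at least 2.\<close>
  have "exp (- (real d * (real d - 2)) * t) = q ^ (d - 2)"
    using assms(1) by (simp add: q_def exp_of_nat_mult[symmetric] of_nat_diff algebra_simps)
  then have "alpha (- (real d * (real d - 2))) t = (1 - q ^ (d - 2)) / (real d * (real d - 2))"
    by (simp add: alpha_def divide_simps)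
  also have "\<dots> < (real (d - 2) * (1 - q)) / (real d * (real d - 2))"
    using one_minus_power_less[OF q, of "d - 2"] assms(1) by (intro divide_strict_right_mono) simp_all
  also have "\<dots> = (1 - q) / real d" using assms(1) by (simp add: of_nat_diff)
  also have "\<dots> = alpha (- real d) t" by (simp add: alpha_def q_def divide_simps)
  finally show ?thesis .
qed

theorem mainTheorem2:
  fixes d N :: nat and \<tau> \<mu> \<mu>P \<mu>T :: real
    and gs hs :: "nat set list"
    and PP TT :: "real mat multiset"
  assumes "d > 3" and "N \<ge> d" and "\<tau> > 0"
    and "gs \<noteq> []" and "\<forall>g \<in> set gs. d_group N d g"
    and "hs \<noteq> []" and "\<forall>h \<in> set hs. d_group N d h"
    and "PP = {#- pairwise_laplacian N d g. g \<in># mset gs#}"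
    and "TT = {#- threeway_laplacian N d h. h \<in># mset hs#}"
    and "\<mu> < 0"
    and "eigenvalue (aggregated_mat N PP) \<mu>"
    and "eigenvalue (aggregated_mat N TT) \<mu>"
    and "\<mu>P = 1 / \<tau> * ln (1 + alpha (- real d) \<tau> * \<mu>)"
    and "\<mu>T = 1 / \<tau> * ln (1 + alpha (- (real d * (real d - 2))) \<tau> * \<mu>)"
  shows "(\<forall>v. eigenvector (aggregated_mat N PP) v \<mu> \<longrightarrow>
              eigenvector (effective_mat N \<tau> PP)
                (map_vec complex_of_real v) (complex_of_real \<mu>P))
       \<and> (\<forall>v. eigenvector (aggregated_mat N TT) v \<mu> \<longrightarrow>
              eigenvector (effective_mat N \<tau> TT)
                (map_vec complex_of_real v) (complex_of_real \<mu>T))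
       \<and> \<mu>P < \<mu>T"
proof -
  have "- pairwise_laplacian N d g = (- 1) \<cdot>\<^sub>m pairwise_laplacian N d g" for g
    by (intro eq_matI) simp_all
  then have PP: "PP = {#(- 1) \<cdot>\<^sub>m pairwise_laplacian N d g. g \<in># mset gs#}"
    using assms(8) by simp
  have "- threeway_laplacian N d g = (- (real d - 2)) \<cdot>\<^sub>m pairwise_laplacian N d g" for g
    unfolding threeway_laplacian_def by (intro eq_matI) (simp_all add: algebra_simps)
  then have TT: "TT = {#(- (real d - 2)) \<cdot>\<^sub>m pairwise_laplacian N d h. h \<in># mset hs#}"
    using assms(9) by simp
  \<comment> \<open>Matches the constants - s d for s = 1 and s = d - 2 with those in
    \<open>\<mu>P\<close> and \<open>\<mu>T\<close>.\<close>
  have ds: "- (1 * real d) = - real d"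
    "- ((real d - 2) * real d) = - (real d * (real d - 2))" by simp_all
  note P = effective_mat_eigenvector[of d 1 \<tau> "mset gs" N PP, unfolded ds, OF _ _ assms(3) _ _ PP]
  note T = effective_mat_eigenvector[of d "real d - 2" \<tau> "mset hs" N TT, unfolded ds, OF _ _ assms(3) _ _ TT]
  have P1: "eigenvector (effective_mat N \<tau> PP) (map_vec complex_of_real v) (complex_of_real \<mu>P)"
    and P2: "1 + alpha (- real d) \<tau> * \<mu> > 0"
    if "eigenvector (aggregated_mat N PP) v \<mu>" for v
    using P[of v \<mu>] that assms by auto
  have T1: "eigenvector (effective_mat N \<tau> TT) (map_vec complex_of_real v) (complex_of_real \<mu>T)"
    if "eigenvector (aggregated_mat N TT) v \<mu>" for v
    using T(1)[of v \<mu>] that assms by auto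
  \<comment> \<open>Some eigenvector exists, so the smaller of the two arguments of
    \<open>ln\<close> is positive and strict monotonicity of \<open>ln\<close> applies.\<close>
  have pos: "1 + alpha (- real d) \<tau> * \<mu> > 0"
    using assms(11) P2 unfolding eigenvalue_def by blast
  \<comment> \<open>The negative sign of \<open>\<mu>\<close> reverses the comparison of the two
    values of \<open>alpha\<close>.\<close>
  have "1 + alpha (- real d) \<tau> * \<mu> < 1 + alpha (- (real d * (real d - 2))) \<tau> * \<mu>"
    using alpha_threeway_less_pairwise[OF assms(1,3)] assms(10) by simp
  then have "\<mu>P < \<mu>T"
    unfolding assms(13,14) using pos assms(3) by (intro mult_strict_left_mono) simp_all
  then show ?thesis using P1 T1 by blast
qed

end
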